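(* Let $k\ge1$ be an integer, let $m\in\{0,1,\ldots,k\}$, and let $y$ be a parameter. Let $L=\left(\frac{1+xy(1+x)^{k-1}}{(1+x)^m},\frac{x}{(1+x)^k}\right)$ and let $\mu_n(y)$ be the $(n,0)$ entry of $L^{-1}$. Writing $\mu_n(y)=\sum_j m_{n,j}y^j$, the matrix $(m_{n,j})_{n,j\ge0}$ equals the Riordan array $\left(g(x)^m,-x\,g(x)^{2k-1}\right)$, where $g(x)$ is the power series satisfying $g(x)=1+x\,g(x)^k$, and this Riordan array is a Riordan involution. *)

theory Defs
  imports "HOL-Computational_Algebra.Computational_Algebra"
begin

text \<open>
  Infinite matrices are functions \<open>nat \<Rightarrow> nat \<Rightarrow> 'a\<close> with rows and columns counted from 0.
  All matrices used here are lower triangular, so the sum defining an entry of a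
  product is finite and stops at the row index.
\<close>

definition lower_triangular :: "(nat \<Rightarrow> nat \<Rightarrow> 'a::zero) \<Rightarrow> bool" where
  "lower_triangular A \<longleftrightarrow> (\<forall>n j. n < j \<longrightarrow> A n j = 0)"

definition ltm_one :: "nat \<Rightarrow> nat \<Rightarrow> 'a::zero_neq_one" where
  "ltm_one n j = (if n = j then 1 else 0)"

definition ltm_mult ::
    "(nat \<Rightarrow> nat \<Rightarrow> 'a::comm_ring_1) \<Rightarrow> (nat \<Rightarrow> nat \<Rightarrow> 'a) \<Rightarrow> nat \<Rightarrow> nat \<Rightarrow> 'a" where
  "ltm_mult A B n j = (\<Sum>i\<le>n. A n i * B i j)"

definition ltm_inverse :: "(nat \<Rightarrow> nat \<Rightarrow> 'a::comm_ring_1) \<Rightarrow> nat \<Rightarrow> nat \<Rightarrow> 'a" where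
  "ltm_inverse A =
     (THE B. lower_triangular B \<and> ltm_mult A B = ltm_one \<and> ltm_mult B A = ltm_one)"

text \<open>
  The Riordan array \<open>(d, h)\<close>: column \<open>j\<close> has generating function \<open>d h\<^sup>j\<close>.
  Over a commutative ring the usual conditions \<open>d(0) \<noteq> 0\<close>, \<open>h(0) = 0\<close>, \<open>h'(0) \<noteq> 0\<close>
  become: \<open>d(0)\<close> and \<open>h'(0)\<close> are units and \<open>h(0) = 0\<close>.
\<close>

definition riordan :: "'a::comm_ring_1 fps \<Rightarrow> 'a fps \<Rightarrow> nat \<Rightarrow> nat \<Rightarrow> 'a" where
  "riordan d h n j = fps_nth (d * h ^ j) n"

definition riordan_pair :: "'a::comm_ring_1 fps \<Rightarrow> 'a fps \<Rightarrow> bool" where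
  "riordan_pair d h \<longleftrightarrow> fps_nth d 0 dvd 1 \<and> fps_nth h 0 = 0 \<and> fps_nth h 1 dvd 1"

definition riordan_involution :: "'a::comm_ring_1 fps \<Rightarrow> 'a fps \<Rightarrow> bool" where
  "riordan_involution d h \<longleftrightarrow>
     riordan_pair d h \<and> ltm_mult (riordan d h) (riordan d h) = ltm_one"

text \<open>
  Reciprocal of a power series with constant term 1. The class operation \<open>inverse\<close> is
  not available here, since a polynomial ring over \<open>'a\<close> is not of class \<open>inverse\<close>.
\<close>

definition fps_recip :: "'a::comm_ring_1 fps \<Rightarrow> 'a fps" where
  "fps_recip f = fps_right_inverse f 1"

lemma fps_recip: "fps_nth f 0 = 1 \<Longrightarrow> f * fps_recip f = 1"
  unfolding fps_recip_def by (rule fps_right_inverse) simp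

definition gen_series :: "nat \<Rightarrow> 'a::comm_ring_1 fps" where
  "gen_series k = (THE g. g = 1 + fps_X * g ^ k)"

lemma power_agree:
  fixes f g :: "'a::comm_ring_1 fps"
  assumes "\<And>i. i \<le> n \<Longrightarrow> fps_nth f i = fps_nth g i"
  shows "i \<le> n \<Longrightarrow> fps_nth (f ^ k) i = fps_nth (g ^ k) i"
proof (induction k arbitrary: i)
  case (Suc k)
  then show ?case using assms by (auto simp: fps_mult_nth intro!: sum.cong)
qed simp

lemma ex1_gen_series: "\<exists>!g::'a::comm_ring_1 fps. g = 1 + fps_X * g ^ k"
proof -
  define F where "F = (\<lambda>g::'a fps. 1 + fps_X * g ^ k)"
  have F0: "fps_nth (F f) 0 = 1" for f
    by (simp add: F_def)
  have FS: "fps_nth (F f) (Suc i) = fps_nth (f ^ k) i" for f i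
    by (simp add: F_def)
  have step: "fps_nth (F f) i = fps_nth (F g) i"
    if "\<And>i. i \<le> n \<Longrightarrow> fps_nth f i = fps_nth g i" "i \<le> Suc n" for f g n i
    using that power_agree[of n f g] by (cases i) (auto simp: F0 FS)
  define G where "G = (\<lambda>n. (F ^^ Suc n) 1)"
  have G: "G (Suc n) = F (G n)" for n by (simp add: G_def)
  have stable: "fps_nth (G (Suc n)) i = fps_nth (G n) i" if "i \<le> n" for i n
    using that
  proof (induction n arbitrary: i)
    case 0
    then show ?case by (simp add: G_def F0)
  next
    case (Suc n)
    show ?case
      unfolding G[of "Suc n"] using step[of n "G (Suc n)" "G n" i] Suc by (simp add: G)
  qed
  define g where "g = Abs_fps (\<lambda>n. fps_nth (G n) n)"
  have agree: "fps_nth (G (i + d)) i = fps_nth g i" for i d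
    by (induction d) (simp_all add: g_def stable)
  have agree': "fps_nth (G n) i = fps_nth g i" if "i \<le> n" for i n
    using agree[of i "n - i"] that by simp
  have "F g = g"
  proof (rule fps_ext)
    fix n
    have "fps_nth (F g) n = fps_nth (F (G n)) n"
      by (rule step[of n]) (simp_all add: agree')
    also have "\<dots> = fps_nth g n"
      using agree'[of n "Suc n"] by (simp add: G)
    finally show "fps_nth (F g) n = fps_nth g n" .
  qed
  moreover have "f = g" if "F f = f" for f
  proof -
    have "\<forall>i\<le>n. fps_nth f i = fps_nth g i" for n
    proof (induction n)
      case 0
      then show ?case using F0[of f] F0[of g] that \<open>F g = g\<close> by simp
    next
      case (Suc n)
      then show ?case using step[of n f g] that \<open>F g = g\<close> by auto
    qed
    then show ?thesis by (auto intro: fps_ext)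
  qed
  ultimately show ?thesis by (metis F_def)
qed

end

(*
  With g = 1 + x g^k, the series g - 1 is the compositional inverse of x / (1 + x)^k. Hence
  L^(-1) has first component F = g^m / (1 + x y g^(2k-1)), and its column 0 is F itself. Reading off
  coefficients of y^j in F (1 + x y g^(2k-1)) = g^m gives g^m (- x g^(2k-1))^j.
  For the involution, put H = - x g^(2k-1). Both g(H) and 1/g solve f = 1 + H f^k, so g(H) = 1/g,
  and thus g^m g(H)^m = 1 and H(H) = - H g(H)^(2k-1) = x.
*)
theory Submission
  imports Defs
begin

lemma fps_unit_mult_left_cancel:
  fixes u a b :: "'a::comm_ring_1 fps"
  assumes "fps_nth u 0 = 1" and "u * a = u * b"
  shows "a = b"
proof -
  have "fps_recip u * u = 1"
    using fps_recip[OF assms(1)] by (simp add: mult.commute)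
  then show ?thesis
    using assms(2) by (metis mult.assoc mult_1_left)
qed

lemma fps_mult_recip_cancel:
  fixes u a :: "'a::comm_ring_1 fps"
  assumes "fps_nth u 0 = 1"
  shows "u * (a * fps_recip u) = a"
  by (metis fps_recip[OF assms] mult.left_commute mult_1_right)

lemma fps_power_equation_unique:
  fixes f g h :: "'a::comm_ring_1 fps"
  assumes h: "fps_nth h 0 = 0" and f: "f = 1 + h * f ^ k" and g: "g = 1 + h * g ^ k"
  shows "f = g"
proof -
  define q where "q = (\<Sum>i<k. g ^ (k - Suc i) * f ^ i)"
  have "f ^ k - g ^ k = (f - g) * q"
    unfolding q_def by (rule power_diff_sumr2)
  moreover have "f - g = h * (f ^ k - g ^ k)"
    using f g by (metis add_diff_cancel_left right_diff_distrib)
  ultimately have "f - g = h * ((f - g) * q)" by simp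
  then have "(1 - h * q) * (f - g) = (1 - h * q) * 0"
    by (simp add: algebra_simps)
  then have "f - g = 0"
    by (rule fps_unit_mult_left_cancel[rotated]) (simp add: h)
  then show ?thesis by simp
qed

lemma gen_series: "gen_series k = 1 + fps_X * gen_series k ^ k"
  unfolding gen_series_def by (rule theI'[OF ex1_gen_series])

lemma gen_series_nth_0: "fps_nth (gen_series k) 0 = 1"
  by (subst gen_series) simp

lemma fps_nth_power_eq_0:
  fixes c :: "'a::comm_ring_1 fps"
  assumes "fps_nth c 0 = 0" and "n < i"
  shows "fps_nth (c ^ i) n = 0"
  using assms by (rule startsby_zero_power_prefix[rule_format])

lemma fps_compose_nth_extend:
  fixes c :: "'a::comm_ring_1 fps"
  assumes "fps_nth c 0 = 0" and "n \<le> N"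
  shows "fps_nth (a oo c) n = (\<Sum>i\<le>N. fps_nth a i * fps_nth (c ^ i) n)"
  unfolding fps_compose_nth atLeast0AtMost
  by (rule sum.mono_neutral_left) (use assms in \<open>auto simp: fps_nth_power_eq_0\<close>)

lemma fps_mult_compose_nth:
  fixes c :: "'a::comm_ring_1 fps"
  assumes "fps_nth c 0 = 0"
  shows "fps_nth (d * (a oo c)) n = (\<Sum>i\<le>n. fps_nth (d * c ^ i) n * fps_nth a i)"
proof -
  have "fps_nth (d * (a oo c)) n
      = (\<Sum>p=0..n. fps_nth d p * (\<Sum>i\<le>n. fps_nth a i * fps_nth (c ^ i) (n - p)))"
    unfolding fps_mult_nth
    by (intro sum.cong refl) (simp add: fps_compose_nth_extend[OF assms, where N = n])
  also have "\<dots> = (\<Sum>p=0..n. \<Sum>i\<le>n. fps_nth d p * fps_nth (c ^ i) (n - p) * fps_nth a i)"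
    by (simp add: sum_distrib_left ac_simps)
  also have "\<dots> = (\<Sum>i\<le>n. \<Sum>p=0..n. fps_nth d p * fps_nth (c ^ i) (n - p) * fps_nth a i)"
    by (rule sum.swap)
  finally show ?thesis
    by (simp add: fps_mult_nth sum_distrib_right)
qed

text \<open>The library has the next two facts over integral domains only.\<close>

lemma fps_compose_mult_distrib_comm_ring:
  fixes c :: "'a::comm_ring_1 fps"
  assumes c: "fps_nth c 0 = 0"
  shows "(a * b) oo c = (a oo c) * (b oo c)"
proof (rule fps_ext)
  fix n
  define t where "t = (\<lambda>i j. fps_nth a i * fps_nth b j * fps_nth (c ^ (i + j)) n)"
  have "fps_nth ((a oo c) * (b oo c)) n = (\<Sum>j\<le>n. fps_nth (c ^ j * (a oo c)) n * fps_nth b j)"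
    by (subst fps_mult_compose_nth[OF c]) (simp add: mult.commute)
  also have "\<dots> = (\<Sum>j\<le>n. \<Sum>i\<le>n. t i j)"
    unfolding fps_mult_compose_nth[OF c]
    by (simp add: t_def sum_distrib_left sum_distrib_right power_add ac_simps)
  also have "\<dots> = (\<Sum>i\<le>n. \<Sum>j\<le>n. t i j)"
    by (rule sum.swap)
  also have "\<dots> = (\<Sum>(i, j)\<in>{..n} \<times> {..n}. t i j)"
    by (rule sum.cartesian_product)
  also have "\<dots> = (\<Sum>(i, j)\<in>{(i, j). i + j \<le> n}. t i j)"
    by (rule sum.mono_neutral_right) (auto simp: t_def intro!: leI dest: fps_nth_power_eq_0[OF c])
  also have "\<dots> = (\<Sum>s\<le>n. \<Sum>i\<le>s. t i (s - i))"
    by (rule sum.triangle_reindex_eq)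
  also have "\<dots> = fps_nth ((a * b) oo c) n"
    by (simp add: fps_compose_nth fps_mult_nth t_def sum_distrib_right atLeast0AtMost)
  finally show "fps_nth ((a * b) oo c) n = fps_nth ((a oo c) * (b oo c)) n" ..
qed

lemma fps_compose_power_comm_ring:
  fixes c :: "'a::comm_ring_1 fps"
  assumes "fps_nth c 0 = 0"
  shows "(a ^ n) oo c = (a oo c) ^ n"
  by (induction n) (simp_all add: fps_compose_mult_distrib_comm_ring[OF assms])

lemma gen_series_compose:
  fixes h :: "'a::comm_ring_1 fps"
  assumes h: "fps_nth h 0 = 0" and f: "f = 1 + h * f ^ k"
  shows "gen_series k oo h = f"
proof (rule fps_power_equation_unique[OF h _ f])
  show "gen_series k oo h = 1 + h * (gen_series k oo h) ^ k"
    by (subst gen_series) (simp add: h fps_compose_add_distrib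
        fps_compose_mult_distrib_comm_ring fps_compose_power_comm_ring)
qed

lemma ltm_mult_riordan:
  fixes d h d' h' :: "'a::comm_ring_1 fps"
  assumes "fps_nth h 0 = 0"
  shows "ltm_mult (riordan d h) (riordan d' h') = riordan (d * (d' oo h)) (h' oo h)"
proof (intro ext)
  fix n j
  have "riordan (d * (d' oo h)) (h' oo h) n j = fps_nth (d * ((d' * h' ^ j) oo h)) n"
    by (simp add: riordan_def mult.assoc fps_compose_mult_distrib_comm_ring[OF assms]
        fps_compose_power_comm_ring[OF assms])
  then show "ltm_mult (riordan d h) (riordan d' h') n j = riordan (d * (d' oo h)) (h' oo h) n j"
    by (simp add: fps_mult_compose_nth[OF assms] ltm_mult_def riordan_def)
qed

lemma riordan_1_X: "riordan 1 fps_X = ltm_one"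
  by (intro ext) (simp add: riordan_def ltm_one_def)

lemma lower_triangular_riordan:
  fixes d h :: "'a::comm_ring_1 fps"
  assumes "fps_nth h 0 = 0"
  shows "lower_triangular (riordan d h)"
  by (auto simp: lower_triangular_def riordan_def fps_mult_nth fps_nth_power_eq_0[OF assms])

lemma ltm_mult_one_left: "ltm_mult ltm_one A = A"
  by (intro ext) (simp add: ltm_mult_def ltm_one_def if_distrib[of "\<lambda>x. x * _"] cong: if_cong)

lemma ltm_mult_one_right:
  assumes "lower_triangular A"
  shows "ltm_mult A ltm_one = A"
  using assms by (intro ext)
    (auto simp: ltm_mult_def ltm_one_def lower_triangular_def if_distrib[of "\<lambda>x. _ * x"] cong: if_cong)

lemma ltm_mult_assoc:
  assumes "lower_triangular B"
  shows "ltm_mult (ltm_mult A B) C = ltm_mult A (ltm_mult B C)"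
proof (intro ext)
  fix n j
  have "ltm_mult A (ltm_mult B C) n j = (\<Sum>i\<le>n. \<Sum>l\<le>i. A n i * (B i l * C l j))"
    by (simp add: ltm_mult_def sum_distrib_left)
  also have "\<dots> = (\<Sum>i\<le>n. \<Sum>l\<le>n. A n i * (B i l * C l j))"
    using assms by (intro sum.cong sum.mono_neutral_left) (auto simp: lower_triangular_def)
  also have "\<dots> = (\<Sum>l\<le>n. \<Sum>i\<le>n. A n i * (B i l * C l j))"
    by (rule sum.swap)
  finally show "ltm_mult (ltm_mult A B) C n j = ltm_mult A (ltm_mult B C) n j"
    by (simp add: ltm_mult_def sum_distrib_right mult.assoc)
qed

lemma ltm_inverse_eqI:
  assumes A: "lower_triangular A" and B: "lower_triangular B"
    and AB: "ltm_mult A B = ltm_one" and BA: "ltm_mult B A = ltm_one"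
  shows "ltm_inverse A = B"
  unfolding ltm_inverse_def
proof (rule the_equality)
  fix B'
  assume B': "lower_triangular B' \<and> ltm_mult A B' = ltm_one \<and> ltm_mult B' A = ltm_one"
  then have "B' = ltm_mult B' (ltm_mult A B)"
    by (simp add: AB ltm_mult_one_right)
  also have "\<dots> = ltm_mult (ltm_mult B' A) B"
    by (simp add: ltm_mult_assoc[OF A])
  also have "\<dots> = B"
    by (simp add: B' ltm_mult_one_left)
  finally show "B' = B" .
qed (use assms in simp)

lemma riordan_involution_gen_series:
  fixes k m :: nat
  assumes "k \<ge> 1"
  defines "g \<equiv> gen_series k :: 'a::comm_ring_1 fps"
  shows "riordan_involution (g ^ m) (- fps_X * g ^ (2 * k - 1))"
proof -
  obtain l where k: "k = Suc l"
    using assms(1) by (cases k) auto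
  define H where "H = - fps_X * g ^ (2 * k - 1)"
  have H0: "fps_nth H 0 = 0" by (simp add: H_def)
  have g0: "fps_nth g 0 = 1" by (simp add: g_def gen_series_nth_0)
  have g: "g = 1 + fps_X * g ^ k" unfolding g_def by (rule gen_series)
  have gl: "2 * k - 1 = l + k" by (simp add: k)
  define r where "r = fps_recip g"
  have gr: "g * r = 1" unfolding r_def by (rule fps_recip[OF g0])
  have gr_pow: "g ^ i * r ^ i = 1" for i
    by (metis gr power_mult_distrib power_one)
  have "g * r = g * (1 - fps_X * g ^ l)"
    using g by (simp add: gr k algebra_simps)
  then have "r = 1 - fps_X * g ^ l"
    by (rule fps_unit_mult_left_cancel[OF g0])
  also have "\<dots> = 1 + H * r ^ k"
    unfolding H_def gl by (simp add: power_add mult.assoc gr_pow)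
  finally have gH: "g oo H = r"
    unfolding g_def by (rule gen_series_compose[OF H0])
  have "g ^ m * (g ^ m oo H) = 1"
    by (simp add: fps_compose_power_comm_ring[OF H0] gH gr_pow)
  moreover have "H oo H = fps_X"
  proof -
    have "H oo H = - (H * r ^ (2 * k - 1))"
      by (subst H_def) (simp add: fps_compose_mult_distrib_comm_ring[OF H0] fps_compose_uminus
          fps_compose_power_comm_ring[OF H0] gH H0)
    then show ?thesis
      by (simp add: H_def mult.assoc gr_pow)
  qed
  ultimately have "ltm_mult (riordan (g ^ m) H) (riordan (g ^ m) H) = ltm_one"
    by (simp add: ltm_mult_riordan[OF H0] riordan_1_X)
  moreover have "fps_nth H 1 = - 1"
    by (simp add: H_def g0 fps_nth_power_0)
  ultimately have "riordan_involution (g ^ m) H"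
    by (simp add: riordan_involution_def riordan_pair_def H0 g0 fps_nth_power_0)
  then show ?thesis unfolding H_def .
qed

lemma ltm_inverse_riordan_gen_series:
  fixes k m :: nat and y :: "'a::comm_ring_1"
  assumes "k \<ge> 1"
  defines "G \<equiv> gen_series k :: 'a fps"
    and "d \<equiv> (1 + fps_X * fps_const y * (1 + fps_X) ^ (k - 1)) * fps_recip ((1 + fps_X) ^ m)"
    and "h \<equiv> fps_X * fps_recip ((1 + fps_X) ^ k)"
  shows "ltm_inverse (riordan d h)
    = riordan (G ^ m * fps_recip (1 + fps_X * fps_const y * G ^ (2 * k - 1))) (G - 1)"
proof -
  obtain l where k: "k = Suc l"
    using assms(1) by (cases k) auto
  have kl: "2 * k - 1 = l + k" by (simp add: k)
  define U where "U = G - 1"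
  define E where "E = 1 + fps_X * fps_const y * G ^ (2 * k - 1)"
  define F where "F = G ^ m * fps_recip E"
  have E0: "fps_nth E 0 = 1" by (simp add: E_def)
  have FE: "E * F = G ^ m"
    unfolding F_def by (rule fps_mult_recip_cancel[OF E0])
  have G: "G = 1 + fps_X * G ^ k" unfolding G_def by (rule gen_series)
  have G0: "fps_nth G 0 = 1" by (simp add: G_def gen_series_nth_0)
  have U: "U = fps_X * G ^ k"
    unfolding U_def using G by (metis add_diff_cancel_left')
  have U0: "fps_nth U 0 = 0" by (simp add: U_def G0)
  have h0: "fps_nth h 0 = 0" by (simp add: h_def)
  define p where "p = (1 + fps_X :: 'a fps)"
  have pow0: "fps_nth (p ^ i) 0 = 1" "fps_nth (G ^ i) 0 = 1" for i
    by (simp_all add: p_def G0 fps_nth_power_0)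
  have hp: "p ^ k * h = fps_X"
    unfolding h_def p_def[symmetric] by (rule fps_mult_recip_cancel[OF pow0(1)])
  have dp: "p ^ m * d = 1 + fps_X * fps_const y * p ^ l"
    unfolding d_def p_def[symmetric] k diff_Suc_1 by (rule fps_mult_recip_cancel[OF pow0(1)])
  have pU: "p oo U = G"
    by (simp add: p_def fps_compose_add_distrib U0) (simp add: U_def)
  have Gh: "G oo h = p"
    unfolding G_def using hp
    by (intro gen_series_compose[OF h0]) (simp add: p_def mult.commute)
  have hU: "h oo U = fps_X"
  proof (rule fps_unit_mult_left_cancel[OF pow0(2)])
    have "G ^ k * (h oo U) = (p ^ k * h) oo U"
      by (simp add: fps_compose_mult_distrib_comm_ring[OF U0] fps_compose_power_comm_ring[OF U0] pU)
    also have "\<dots> = G ^ k * fps_X"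
      unfolding hp by (simp add: U0) (simp add: U mult.commute)
    finally show "G ^ k * (h oo U) = G ^ k * fps_X" .
  qed
  have Uh: "U oo h = fps_X"
    by (simp add: U_def fps_compose_sub_distrib Gh) (simp add: p_def)
  have dU: "G ^ m * (d oo U) = E"
  proof -
    have "G ^ m * (d oo U) = (p ^ m * d) oo U"
      by (simp add: fps_compose_mult_distrib_comm_ring[OF U0] fps_compose_power_comm_ring[OF U0] pU)
    also have "\<dots> = 1 + U * fps_const y * G ^ l"
      unfolding dp by (simp add: fps_compose_add_distrib U0 pU
          fps_compose_mult_distrib_comm_ring fps_compose_power_comm_ring)
    finally show ?thesis
      unfolding E_def kl U by (simp add: power_add ac_simps)
  qed
  have Eh: "E oo h = p ^ m * d"
  proof -
    have "E oo h = 1 + h * fps_const y * p ^ (l + k)"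
      unfolding E_def kl by (simp add: fps_compose_add_distrib h0 Gh
          fps_compose_mult_distrib_comm_ring fps_compose_power_comm_ring)
    also have "\<dots> = 1 + (p ^ k * h) * fps_const y * p ^ l"
      by (simp add: power_add ac_simps)
    finally show ?thesis by (simp add: hp dp)
  qed
  have FdU: "F * (d oo U) = 1"
  proof (rule fps_unit_mult_left_cancel[OF E0])
    show "E * (F * (d oo U)) = E * 1"
      by (simp add: mult.assoc[symmetric] FE dU)
  qed
  have dFh: "d * (F oo h) = 1"
  proof (rule fps_unit_mult_left_cancel[OF pow0(1)])
    have "p ^ m * (d * (F oo h)) = (E * F) oo h"
      by (simp add: fps_compose_mult_distrib_comm_ring[OF h0] Eh mult.assoc)
    then show "p ^ m * (d * (F oo h)) = p ^ m * 1"
      by (simp add: FE fps_compose_power_comm_ring[OF h0] Gh)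
  qed
  have "ltm_inverse (riordan d h) = riordan F U"
    by (rule ltm_inverse_eqI)
      (simp_all add: lower_triangular_riordan h0 U0 ltm_mult_riordan hU Uh FdU dFh riordan_1_X)
  then show ?thesis by (simp add: F_def E_def U_def)
qed

definition fps_poly_const :: "'a::comm_ring_1 fps \<Rightarrow> 'a poly fps" where
  "fps_poly_const f = Abs_fps (\<lambda>n. [:fps_nth f n:])"

definition fps_slice :: "nat \<Rightarrow> 'a::comm_ring_1 poly fps \<Rightarrow> 'a fps" where
  "fps_slice j F = Abs_fps (\<lambda>n. coeff (fps_nth F n) j)"

lemma fps_poly_const_1: "fps_poly_const 1 = 1"
  by (rule fps_ext) (simp add: fps_poly_const_def)

lemma fps_poly_const_X: "fps_poly_const fps_X = fps_X"
  by (rule fps_ext) (simp add: fps_poly_const_def fps_X_def)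

lemma fps_poly_const_add: "fps_poly_const (f + g) = fps_poly_const f + fps_poly_const g"
  by (rule fps_ext) (simp add: fps_poly_const_def)

lemma fps_slice_poly_const_mult: "fps_slice j (fps_poly_const f * F) = f * fps_slice j F"
  by (rule fps_ext) (simp add: fps_slice_def fps_poly_const_def fps_mult_nth coeff_sum)

lemma fps_slice_inject: "(\<And>j. fps_slice j F = fps_slice j G) \<Longrightarrow> F = G"
  by (auto simp: fps_slice_def fps_eq_iff poly_eq_iff)

lemma fps_slice_poly_const: "fps_slice j (fps_poly_const f) = (if j = 0 then f else 0)"
  by (rule fps_ext) (auto simp: fps_slice_def fps_poly_const_def coeff_pCons')

lemma fps_poly_const_mult: "fps_poly_const (f * g) = fps_poly_const f * fps_poly_const g"
  by (rule fps_slice_inject) (simp add: fps_slice_poly_const_mult fps_slice_poly_const)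

lemma fps_poly_const_power: "fps_poly_const (f ^ n) = fps_poly_const f ^ n"
  by (induction n) (simp_all add: fps_poly_const_1 fps_poly_const_mult)

lemma fps_poly_const_gen_series: "fps_poly_const (gen_series k) = gen_series k"
proof (rule fps_power_equation_unique[where h = fps_X and k = k])
  show "fps_poly_const (gen_series k) = 1 + fps_X * fps_poly_const (gen_series k :: 'a fps) ^ k"
    by (subst gen_series)
      (simp only: fps_poly_const_add fps_poly_const_mult fps_poly_const_power
        fps_poly_const_1 fps_poly_const_X)
qed (simp_all add: gen_series[symmetric])

lemma fps_slice_add: "fps_slice j (F + G) = fps_slice j F + fps_slice j G"
  by (rule fps_ext) (simp add: fps_slice_def)

lemma fps_slice_var_mult_0: "fps_slice 0 (fps_const [:0, 1:] * F) = 0"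
  by (rule fps_ext) (simp add: fps_slice_def)

lemma fps_slice_var_mult_Suc: "fps_slice (Suc j) (fps_const [:0, 1:] * F) = fps_slice j F"
  by (rule fps_ext) (simp add: fps_slice_def)

lemma fps_slice_geometric:
  fixes a b :: "'a::comm_ring_1 fps"
  assumes F: "(1 + fps_const [:0, 1:] * fps_poly_const b) * F = fps_poly_const a"
  shows "fps_slice j F = a * (- b) ^ j"
proof -
  have slice: "fps_slice i F + fps_slice i (fps_const [:0, 1:] * (fps_poly_const b * F))
      = (if i = 0 then a else 0)" for i
    unfolding fps_slice_add[symmetric] fps_slice_poly_const[symmetric] F[symmetric]
    by (simp add: algebra_simps)
  show ?thesis
  proof (induction j)
    case 0
    then show ?case using slice[of 0] by (simp add: fps_slice_var_mult_0)
  next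
    case (Suc j)
    have "fps_slice (Suc j) F = - (b * fps_slice j F)"
      using slice[of "Suc j"]
      by (simp add: fps_slice_var_mult_Suc fps_slice_poly_const_mult eq_neg_iff_add_eq_0)
    then show ?case by (simp add: Suc.IH ac_simps)
  qed
qed

theorem mainTheorem10:
  fixes k m :: nat
    and y :: "'a::comm_ring_1 poly"
    and g :: "'a fps"
    and L :: "nat \<Rightarrow> nat \<Rightarrow> 'a poly"
    and \<mu> :: "nat \<Rightarrow> 'a poly"
  assumes "k \<ge> 1" and "m \<le> k"
  defines "y \<equiv> [:0, 1:]"
    and "L \<equiv> riordan
           ((1 + fps_X * fps_const y * (1 + fps_X) ^ (k - 1)) * fps_recip ((1 + fps_X) ^ m))
           (fps_X * fps_recip ((1 + fps_X) ^ k))"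
    and "\<mu> \<equiv> \<lambda>n. ltm_inverse L n 0"
    and "g \<equiv> gen_series k"
  shows "(\<lambda>n j. coeff (\<mu> n) j) = riordan (g ^ m) (- fps_X * g ^ (2 * k - 1))
         \<and> riordan_involution (g ^ m) (- fps_X * g ^ (2 * k - 1))"
proof
  show "riordan_involution (g ^ m) (- fps_X * g ^ (2 * k - 1))"
    unfolding g_def by (rule riordan_involution_gen_series[OF assms(1)])
next
  define G where "G = (gen_series k :: 'a poly fps)"
  define E where "E = 1 + fps_X * fps_const y * G ^ (2 * k - 1)"
  define F where "F = G ^ m * fps_recip E"
  have G: "G = fps_poly_const g"
    by (simp add: G_def g_def fps_poly_const_gen_series)
  have "E * F = fps_poly_const (g ^ m)"
    unfolding F_def fps_poly_const_power G[symmetric]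
    by (intro fps_mult_recip_cancel) (simp add: E_def)
  moreover have "E = 1 + fps_const [:0, 1:] * fps_poly_const (fps_X * g ^ (2 * k - 1))"
    by (simp add: E_def y_def G fps_poly_const_mult fps_poly_const_X fps_poly_const_power ac_simps)
  ultimately have slice: "fps_slice j F = g ^ m * (- (fps_X * g ^ (2 * k - 1))) ^ j" for j
    by (intro fps_slice_geometric) simp
  have "\<mu> n = fps_nth F n" for n
    unfolding \<mu>_def L_def ltm_inverse_riordan_gen_series[OF assms(1)]
    by (simp add: riordan_def F_def E_def G_def)
  then have "coeff (\<mu> n) j = fps_nth (fps_slice j F) n" for n j
    by (simp add: fps_slice_def)
  then show "(\<lambda>n j. coeff (\<mu> n) j) = riordan (g ^ m) (- fps_X * g ^ (2 * k - 1))"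
    by (intro ext) (simp add: riordan_def slice)
qed

end
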